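(* Let $X$ be a real random variable and let $F,U:\mathbb{R}\to\mathbb{R}$ satisfy $E[e^{\theta F(X)}]<\infty$ and $E[e^{\theta U(X)}]<\infty$ for all $\theta\in\mathbb{R}$. Suppose that $E[F(X)]=E[U(X)]=0$ and that $\gamma:=\mathrm{Cov}(F(X),U(X))$ is nonzero. For $\varepsilon,u>0$ let $$\Delta(\varepsilon,u):=\max\{\Lambda_+^*(\varepsilon,u),\Gamma_+^*(\varepsilon,u)\}-\Lambda^*(\varepsilon),$$ with $\Lambda_+^*$, $\Gamma_+^*$, $\Lambda^*$ as defined in the context. Then there exists $\varepsilon_0>0$ such that, for each $0<\varepsilon<\varepsilon_0$, there exists $u_0=u_0(\varepsilon)>0$ such that $\Delta(\varepsilon,u)>0$ for all $u\in(0,u_0)$.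
   Context: Functions are Borel measurable. For $\varepsilon,u>0$ (with $E[F(X)]=E[U(X)]=0$), define $$\Lambda^*(\varepsilon):=\sup_{\theta\ge0}\{\theta\varepsilon-\Lambda(\theta)\},\qquad \Lambda(\theta):=\log E[e^{\theta F(X)}],$$ $$\Lambda_+^*(\varepsilon,u):=\sup_{\theta_1\ge0,\theta_2\ge0}\{\theta_1\varepsilon-\theta_2u-\log E[\exp\{\theta_1F(X)-\theta_2U(X)\}]\},$$ $$\Gamma_+^*(\varepsilon,u):=\sup_{\theta_1\ge0,\theta_2\ge0}\{\theta_1\varepsilon-\theta_2u-\log E[\exp\{\theta_1F(X)+\theta_2U(X)\}]\}.$$ Here $\Lambda^*(\varepsilon)$ is the large deviations exponent of $\Pr\{\sum_{i\le n}F(X_i)>n\varepsilon\}$ for i.i.d. copies $X_i$ of $X$, and $\max\{\Lambda_+^*,\Gamma_+^*\}$ is the exponent in the exponential upper bound for $\Pr\{\sum_{i\le n}F(X_i)>n\varepsilon,\ |\sum_{i\le n}U(X_i)|<nu\}$. *)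

theory Defs
  imports "HOL-Probability.Probability"
begin

definition covariance :: "'a measure \<Rightarrow> ('a \<Rightarrow> real) \<Rightarrow> ('a \<Rightarrow> real) \<Rightarrow> real" where
  "covariance M Y Z =
     (\<integral>\<omega>. (Y \<omega> - (\<integral>\<omega>'. Y \<omega>' \<partial>M)) * (Z \<omega> - (\<integral>\<omega>'. Z \<omega>' \<partial>M)) \<partial>M)"

text \<open>
  The suprema below range over unbounded parameter sets and can be infinite, so they are taken in
  \<^typ>\<open>ereal\<close>. The logarithms are real-valued: they are used only when all exponential moments of
  \<open>F(X)\<close> and \<open>U(X)\<close> are finite, in which case every expectation below is finite and positive.
\<close>

definition Lambda :: "'a measure \<Rightarrow> ('a \<Rightarrow> real) \<Rightarrow> (real \<Rightarrow> real) \<Rightarrow> real \<Rightarrow> real" where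
  "Lambda M X F \<theta> = ln (\<integral>\<omega>. exp (\<theta> * F (X \<omega>)) \<partial>M)"

definition Lambda_star :: "'a measure \<Rightarrow> ('a \<Rightarrow> real) \<Rightarrow> (real \<Rightarrow> real) \<Rightarrow> real \<Rightarrow> ereal" where
  "Lambda_star M X F \<epsilon> = (SUP \<theta>\<in>{0..}. ereal (\<theta> * \<epsilon> - Lambda M X F \<theta>))"

definition Lambda_plus_star ::
  "'a measure \<Rightarrow> ('a \<Rightarrow> real) \<Rightarrow> (real \<Rightarrow> real) \<Rightarrow> (real \<Rightarrow> real) \<Rightarrow> real \<Rightarrow> real \<Rightarrow> ereal" where
  "Lambda_plus_star M X F U \<epsilon> u =
     (SUP (\<theta>1, \<theta>2) \<in> {0..} \<times> {0..}.
        ereal (\<theta>1 * \<epsilon> - \<theta>2 * u - ln (\<integral>\<omega>. exp (\<theta>1 * F (X \<omega>) - \<theta>2 * U (X \<omega>)) \<partial>M)))"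

definition Gamma_plus_star ::
  "'a measure \<Rightarrow> ('a \<Rightarrow> real) \<Rightarrow> (real \<Rightarrow> real) \<Rightarrow> (real \<Rightarrow> real) \<Rightarrow> real \<Rightarrow> real \<Rightarrow> ereal" where
  "Gamma_plus_star M X F U \<epsilon> u =
     (SUP (\<theta>1, \<theta>2) \<in> {0..} \<times> {0..}.
        ereal (\<theta>1 * \<epsilon> - \<theta>2 * u - ln (\<integral>\<omega>. exp (\<theta>1 * F (X \<omega>) + \<theta>2 * U (X \<omega>)) \<partial>M)))"

text \<open>
  Taking \<open>\<theta>2 = 0\<close> shows that the maximum is at least \<open>Lambda_star M X F \<epsilon>\<close>, so when the latter is
  infinite the difference is the indeterminate form \<open>\<infinity> - \<infinity>\<close>. On \<^typ>\<open>ereal\<close> this evaluates to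
  \<open>\<infinity>\<close>; the explicit value 0 ensures that an undefined difference does not count as positive.
\<close>

definition Delta ::
  "'a measure \<Rightarrow> ('a \<Rightarrow> real) \<Rightarrow> (real \<Rightarrow> real) \<Rightarrow> (real \<Rightarrow> real) \<Rightarrow> real \<Rightarrow> real \<Rightarrow> ereal" where
  "Delta M X F U \<epsilon> u =
     (if Lambda_star M X F \<epsilon> = \<infinity> then 0
      else max (Lambda_plus_star M X F U \<epsilon> u) (Gamma_plus_star M X F U \<epsilon> u)
             - Lambda_star M X F \<epsilon>)"

end

theory Submission
  imports Defs
begin

text \<open>
  Write \<open>f = F(X)\<close>, \<open>g = U(X)\<close> and \<open>D(\<theta>) = E[g exp(\<theta> f)]\<close>. Since \<open>D(0) = 0\<close> and \<open>D'(0) = \<gamma> \<noteq> 0\<close>,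
  \<open>D\<close> has no zero on some interval \<open>(0, \<delta>)\<close>. For \<open>\<epsilon> < \<Lambda>(\<delta>) / \<delta>\<close> the supremum defining \<open>\<Lambda>*(\<epsilon>)\<close> is
  attained at some \<open>\<theta>*\<close> in \<open>(0, \<delta>)\<close>. As \<open>D(\<theta>*)\<close> is the derivative of \<open>t \<mapsto> E[exp(\<theta>* f + t g)]\<close> at
  \<open>t = 0\<close>, moving \<open>t\<close> slightly away from 0, in the direction opposite to the sign of \<open>D(\<theta>*)\<close>, strictly
  decreases this expectation; the gain beats the penalty \<open>\<bar>t\<bar> u\<close> when \<open>u\<close> is small.
\<close>

section \<open>Exponential estimates and differentiation under the expectation\<close>

lemma abs_exp_minus_linear_le:
  fixes x :: real
  shows "\<bar>exp x - 1 - x\<bar> \<le> x\<^sup>2 * exp \<bar>x\<bar>"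
proof -
  \<comment> \<open>Lagrange form of the Taylor remainder;
    \<open>\<bar>t\<bar> \<le> \<bar>x\<bar>\<close> bounds its exponential, and the factor 1/2 is
    given away.\<close>
  obtain t where t: "\<bar>t\<bar> \<le> \<bar>x\<bar>" "exp x = (\<Sum>m<2. (x ^ m) / fact m) + (exp t / fact 2) * x\<^sup>2"
    using Maclaurin_exp_le[of x 2] by blast
  have "exp x - 1 - x = exp t / 2 * x\<^sup>2"
    using t(2) by (simp add: numeral_2_eq_2)
  hence "\<bar>exp x - 1 - x\<bar> = exp t / 2 * x\<^sup>2"
    by (simp only: abs_mult) simp
  also have "\<dots> \<le> exp \<bar>x\<bar> * x\<^sup>2"
  proof (rule mult_right_mono)
    have "exp t \<le> exp \<bar>x\<bar>" using t(1) by simp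
    thus "exp t / 2 \<le> exp \<bar>x\<bar>" by (smt (verit) exp_gt_zero field_sum_of_halves)
  qed simp
  finally show ?thesis by (simp add: mult.commute)
qed

text \<open>With \<open>y = exp x\<close> the equation reads \<open>ln y = y - 1\<close>, which
  forces \<open>y = 1\<close>. This equality case later makes the bound
  \<open>E[exp f] \<ge> 1\<close> strict.\<close>

lemma exp_eq_one_plus_self_iff:
  fixes x :: real
  shows "exp x = 1 + x \<longleftrightarrow> x = 0"
proof
  assume "exp x = 1 + x"
  hence "ln (exp x) = exp x - 1" unfolding ln_exp by linarith
  hence "exp x = 1" by (rule ln_eq_minus_one[rotated]) simp
  thus "x = 0" by simp
qed simp

text \<open>Dividing the error by \<open>t\<close> leaves at most \<open>C * \<bar>t\<bar>\<close>,
  so the difference quotient tends to \<open>d\<close>.\<close>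

lemma has_real_derivative_at_0_if_quadratic_error:
  fixes J :: "real \<Rightarrow> real"
  assumes "\<And>t. \<bar>t\<bar> \<le> 1 \<Longrightarrow> \<bar>J t - J 0 - t * d\<bar> \<le> C * t\<^sup>2"
  shows "(J has_real_derivative d) (at 0)"
proof -
  have ev: "\<forall>\<^sub>F t in at 0. norm ((J t - J 0) / t - d) \<le> C * \<bar>t\<bar>"
    unfolding eventually_at
  proof (intro exI[of _ 1] conjI ballI impI)
    fix t :: real assume t: "t \<noteq> 0 \<and> dist t 0 < 1"
    have "(J t - J 0) / t - d = (J t - J 0 - t * d) / t"
      using t by (simp add: field_simps)
    hence "norm ((J t - J 0) / t - d) = \<bar>J t - J 0 - t * d\<bar> / \<bar>t\<bar>"
      by (simp add: abs_divide)
    also have "\<dots> \<le> C * t\<^sup>2 / \<bar>t\<bar>"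
      using assms[of t] t by (intro divide_right_mono) auto
    also have "\<dots> = C * \<bar>t\<bar>"
      using t by (simp add: power2_eq_square divide_simps abs_if)
    finally show "norm ((J t - J 0) / t - d) \<le> C * \<bar>t\<bar>" .
  qed simp
  have "((\<lambda>t::real. C * \<bar>t\<bar>) \<longlongrightarrow> C * \<bar>0\<bar>) (at 0)"
    by (intro tendsto_intros)
  hence lim: "((\<lambda>t::real. C * \<bar>t\<bar>) \<longlongrightarrow> 0) (at 0)" by simp
  have "((\<lambda>t. (J t - J 0) / t - d) \<longlongrightarrow> 0) (at 0)"
    by (rule Lim_null_comparison[OF ev lim])
  hence "((\<lambda>t. (J t - J 0) / t) \<longlongrightarrow> d) (at 0)"
    by (simp add: LIM_zero_iff)
  thus ?thesis by (simp add: DERIV_def)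
qed

text \<open>The first-order remainder of \<open>exp (t * g)\<close> is of order
  \<open>t\<^sup>2\<close> with an integrable factor. The 2 in \<open>dom\<close> pays for two
  things: one \<open>exp \<bar>g\<bar>\<close> absorbs \<open>g\<^sup>2\<close>, the other bounds
  \<open>exp \<bar>t * g\<bar>\<close> for \<open>\<bar>t\<bar> \<le> 1\<close>. The weight
  \<open>h\<close> will be an exponential tilt or the variable \<open>U(X)\<close>.\<close>

lemma has_real_derivative_exp_tilted_integral:
  fixes h g :: "'a \<Rightarrow> real"
  assumes [measurable]: "h \<in> borel_measurable M" "g \<in> borel_measurable M"
    and dom: "integrable M (\<lambda>\<omega>. \<bar>h \<omega>\<bar> * exp (2 * \<bar>g \<omega>\<bar>))"
  shows "((\<lambda>t. \<integral>\<omega>. h \<omega> * exp (t * g \<omega>) \<partial>M) has_real_derivative (\<integral>\<omega>. h \<omega> * g \<omega> \<partial>M)) (at 0)"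
proof (rule has_real_derivative_at_0_if_quadratic_error)
  fix t :: real assume t: "\<bar>t\<bar> \<le> 1"
  let ?B = "\<lambda>\<omega>. \<bar>h \<omega>\<bar> * exp (2 * \<bar>g \<omega>\<bar>)"
  have tg: "\<bar>t * g \<omega>\<bar> \<le> \<bar>g \<omega>\<bar>" for \<omega>
    using mult_right_mono[OF t, of "\<bar>g \<omega>\<bar>"] by (simp add: abs_mult)
  have int_h: "integrable M h"
    by (rule Bochner_Integration.integrable_bound[OF dom])
      (auto simp: abs_mult mult_le_cancel_left1)
  have int_hg: "integrable M (\<lambda>\<omega>. h \<omega> * g \<omega>)"
  proof (rule Bochner_Integration.integrable_bound[OF dom])
    have "\<bar>g \<omega>\<bar> \<le> exp (2 * \<bar>g \<omega>\<bar>)" for \<omega>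
      using exp_ge_add_one_self[of "2 * \<bar>g \<omega>\<bar>"] by linarith
    thus "AE \<omega> in M. norm (h \<omega> * g \<omega>) \<le> norm (?B \<omega>)"
      by (auto simp: abs_mult intro!: mult_left_mono)
  qed simp
  have int_he: "integrable M (\<lambda>\<omega>. h \<omega> * exp (t * g \<omega>))"
  proof (rule Bochner_Integration.integrable_bound[OF dom])
    have "t * g \<omega> \<le> 2 * \<bar>g \<omega>\<bar>" for \<omega>
      using tg[of \<omega>] by linarith
    thus "AE \<omega> in M. norm (h \<omega> * exp (t * g \<omega>)) \<le> norm (?B \<omega>)"
      by (auto simp: abs_mult intro!: mult_left_mono)
  qed simp
  have pt: "\<bar>h \<omega> * exp (t * g \<omega>) - h \<omega> - t * (h \<omega> * g \<omega>)\<bar> \<le> 2 * t\<^sup>2 * ?B \<omega>" for \<omega>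
  proof -
    \<comment> \<open>The quadratic Taylor term of \<open>exp \<bar>g\<bar>\<close> trades the
      square of \<open>g\<close> for an exponential.\<close>
    have "\<bar>g \<omega>\<bar>\<^sup>2 / 2 \<le> exp \<bar>g \<omega>\<bar>"
      using exp_lower_Taylor_quadratic[of "\<bar>g \<omega>\<bar>"] by simp
    hence g2: "(g \<omega>)\<^sup>2 \<le> 2 * exp \<bar>g \<omega>\<bar>" by simp
    have "\<bar>exp (t * g \<omega>) - 1 - t * g \<omega>\<bar> \<le> (t * g \<omega>)\<^sup>2 * exp \<bar>t * g \<omega>\<bar>"
      by (rule abs_exp_minus_linear_le)
    also have "\<dots> \<le> (t\<^sup>2 * (2 * exp \<bar>g \<omega>\<bar>)) * exp \<bar>g \<omega>\<bar>"
      unfolding power_mult_distrib using g2 tg[of \<omega>]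
      by (intro mult_mono mult_left_mono) auto
    also have "\<dots> = 2 * t\<^sup>2 * exp (2 * \<bar>g \<omega>\<bar>)"
      by (simp add: exp_double power2_eq_square)
    finally have "\<bar>h \<omega>\<bar> * \<bar>exp (t * g \<omega>) - 1 - t * g \<omega>\<bar> \<le> \<bar>h \<omega>\<bar> * (2 * t\<^sup>2 * exp (2 * \<bar>g \<omega>\<bar>))"
      by (rule mult_left_mono) simp
    moreover have "h \<omega> * exp (t * g \<omega>) - h \<omega> - t * (h \<omega> * g \<omega>) = h \<omega> * (exp (t * g \<omega>) - 1 - t * g \<omega>)"
      by (simp add: algebra_simps)
    ultimately show ?thesis by (simp only: abs_mult mult_ac)
  qed
  have "\<bar>(\<integral>\<omega>. h \<omega> * exp (t * g \<omega>) \<partial>M) - (\<integral>\<omega>. h \<omega> \<partial>M) - t * (\<integral>\<omega>. h \<omega> * g \<omega> \<partial>M)\<bar>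
      = \<bar>\<integral>\<omega>. h \<omega> * exp (t * g \<omega>) - h \<omega> - t * (h \<omega> * g \<omega>) \<partial>M\<bar>"
    using int_h int_hg int_he by simp
  also have "\<dots> \<le> (\<integral>\<omega>. \<bar>h \<omega> * exp (t * g \<omega>) - h \<omega> - t * (h \<omega> * g \<omega>)\<bar> \<partial>M)"
    by (rule integral_abs_bound)
  also have "\<dots> \<le> (\<integral>\<omega>. 2 * t\<^sup>2 * ?B \<omega> \<partial>M)"
    using int_h int_hg int_he dom pt by (intro integral_mono) auto
  also have "\<dots> = (2 * (\<integral>\<omega>. ?B \<omega> \<partial>M)) * t\<^sup>2"
    by simp
  finally show "\<bar>(\<integral>\<omega>. h \<omega> * exp (t * g \<omega>) \<partial>M) - (\<integral>\<omega>. h \<omega> * exp (0 * g \<omega>) \<partial>M)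
      - t * (\<integral>\<omega>. h \<omega> * g \<omega> \<partial>M)\<bar> \<le> (2 * (\<integral>\<omega>. ?B \<omega> \<partial>M)) * t\<^sup>2"
    by simp
qed

section \<open>Joint exponential moments from marginal ones\<close>

lemma integrable_exp_abs_add:
  fixes f g :: "'a \<Rightarrow> real"
  assumes [measurable]: "f \<in> borel_measurable M" "g \<in> borel_measurable M"
    and f: "\<And>\<theta>. integrable M (\<lambda>\<omega>. exp (\<theta> * f \<omega>))"
    and g: "\<And>\<theta>. integrable M (\<lambda>\<omega>. exp (\<theta> * g \<omega>))"
  shows "integrable M (\<lambda>\<omega>. exp (a * \<bar>f \<omega>\<bar> + b * \<bar>g \<omega>\<bar>))"
proof (rule Bochner_Integration.integrable_bound)
  let ?S = "\<lambda>\<omega>. (exp ((2 * a) * f \<omega>) + exp ((- 2 * a) * f \<omega>)) +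
                 (exp ((2 * b) * g \<omega>) + exp ((- 2 * b) * g \<omega>))"
  show "integrable M ?S"
    by (intro Bochner_Integration.integrable_add f g)
  have "exp (a * \<bar>f \<omega>\<bar> + b * \<bar>g \<omega>\<bar>) \<le> ?S \<omega>" for \<omega>
  proof -
    have "exp (a * \<bar>f \<omega>\<bar> + b * \<bar>g \<omega>\<bar>) = exp (a * \<bar>f \<omega>\<bar>) * exp (b * \<bar>g \<omega>\<bar>)"
      by (rule exp_add)
    \<comment> \<open>The bound \<open>2 * x * y \<le> x\<^sup>2 + y\<^sup>2\<close> separates the
      two variables, at the cost of doubling the exponents.\<close>
    also have "\<dots> \<le> (exp (a * \<bar>f \<omega>\<bar>))\<^sup>2 + (exp (b * \<bar>g \<omega>\<bar>))\<^sup>2"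
      using sum_squares_bound[of "exp (a * \<bar>f \<omega>\<bar>)" "exp (b * \<bar>g \<omega>\<bar>)"]
        mult_pos_pos[OF exp_gt_zero[of "a * \<bar>f \<omega>\<bar>"] exp_gt_zero[of "b * \<bar>g \<omega>\<bar>"]] by linarith
    also have "\<dots> = exp (2 * a * \<bar>f \<omega>\<bar>) + exp (2 * b * \<bar>g \<omega>\<bar>)"
      by (simp add: exp_double mult.assoc)
    \<comment> \<open>Each absolute value is the variable or its negative, so one of the two signed
      exponentials is matched exactly and the other is positive.\<close>
    also have "\<dots> \<le> ?S \<omega>"
      by (intro add_mono) (auto simp: abs_if)
    finally show ?thesis .
  qed
  thus "AE \<omega> in M. norm (exp (a * \<bar>f \<omega>\<bar> + b * \<bar>g \<omega>\<bar>)) \<le> norm (?S \<omega>)"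
    by (intro AE_I2) (smt (verit) exp_gt_zero real_norm_def)
qed simp

section \<open>Moment generating functions and their logarithms\<close>

lemma (in prob_space) expectation_exp_gt_1:
  fixes f :: "'a \<Rightarrow> real"
  assumes "integrable M f" "expectation f = 0" "integrable M (\<lambda>\<omega>. exp (f \<omega>))"
    and "\<not> (AE \<omega> in M. f \<omega> = 0)"
  shows "expectation (\<lambda>\<omega>. exp (f \<omega>)) > 1"
proof -
  let ?r = "\<lambda>\<omega>. exp (f \<omega>) - (1 + f \<omega>)"
  have int: "integrable M ?r" using assms by simp
  have nonneg: "AE \<omega> in M. 0 \<le> ?r \<omega>" by simp
  \<comment> \<open>The gap between \<open>exp\<close> and its tangent at 0 is nonnegative and
    vanishes only where \<open>f\<close> does, so its mean is zero only if \<open>f\<close> is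
    almost surely zero.\<close>
  have "?r \<omega> = 0 \<longleftrightarrow> f \<omega> = 0" for \<omega>
    using exp_eq_one_plus_self_iff[of "f \<omega>"] by auto
  hence "expectation ?r \<noteq> 0"
    using assms(4) integral_nonneg_eq_0_iff_AE[OF int nonneg] by simp
  moreover have "expectation ?r \<ge> 0"
    by (rule integral_nonneg_AE[OF nonneg])
  moreover have "expectation ?r = expectation (\<lambda>\<omega>. exp (f \<omega>)) - 1"
    using assms by (simp add: prob_space)
  ultimately show ?thesis by simp
qed

lemma (in prob_space) expectation_exp_pos:
  fixes f :: "'a \<Rightarrow> real"
  assumes "integrable M (\<lambda>\<omega>. exp (f \<omega>))"
  shows "expectation (\<lambda>\<omega>. exp (f \<omega>)) > 0"
proof -
  have "expectation (\<lambda>\<omega>. exp (f \<omega>)) \<noteq> 0"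
    using integral_nonneg_eq_0_iff_AE[OF assms] AE_False by simp
  moreover have "expectation (\<lambda>\<omega>. exp (f \<omega>)) \<ge> 0" by simp
  ultimately show ?thesis by linarith
qed

text \<open>The slope \<open>L \<theta> / \<theta>\<close> of the log moment generating function is
  nondecreasing: apply Jensen to the power \<open>\<theta> / \<delta> \<ge> 1\<close>, which is
  convex on the positive reals, and take logarithms.\<close>

lemma (in prob_space) ln_expectation_exp_scale_mono:
  fixes f :: "'a \<Rightarrow> real"
  assumes int: "\<And>\<theta>. integrable M (\<lambda>\<omega>. exp (\<theta> * f \<omega>))" and "0 < \<delta>" "\<delta> \<le> \<theta>"
  shows "\<theta> * ln (expectation (\<lambda>\<omega>. exp (\<delta> * f \<omega>))) \<le> \<delta> * ln (expectation (\<lambda>\<omega>. exp (\<theta> * f \<omega>)))"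
proof -
  have eq: "exp (\<delta> * f \<omega>) powr (\<theta> / \<delta>) = exp (\<theta> * f \<omega>)" for \<omega>
    using assms by (simp add: powr_def)
  have "expectation (\<lambda>\<omega>. exp (\<delta> * f \<omega>)) powr (\<theta> / \<delta>) \<le> expectation (\<lambda>\<omega>. exp (\<delta> * f \<omega>) powr (\<theta> / \<delta>))"
    by (rule jensens_inequality[where I = "{0<..}" and a = 0])
      (use assms eq powr_convex[of "\<theta> / \<delta>"] in auto)
  hence "expectation (\<lambda>\<omega>. exp (\<delta> * f \<omega>)) powr (\<theta> / \<delta>) \<le> expectation (\<lambda>\<omega>. exp (\<theta> * f \<omega>))"
    by (simp add: eq)
  moreover have "expectation (\<lambda>\<omega>. exp (\<delta> * f \<omega>)) powr (\<theta> / \<delta>) > 0"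
    using expectation_exp_pos[OF int[of \<delta>]] by simp
  ultimately have "ln (expectation (\<lambda>\<omega>. exp (\<delta> * f \<omega>)) powr (\<theta> / \<delta>))
      \<le> ln (expectation (\<lambda>\<omega>. exp (\<theta> * f \<omega>)))"
    using expectation_exp_pos[OF int[of \<theta>]] by (simp only: ln_le_cancel_iff)
  thus ?thesis
    using expectation_exp_pos[OF int[of \<delta>]] assms by (simp add: ln_powr field_simps)
qed

text \<open>The objective starts at 0 with slope \<open>\<epsilon> > 0\<close>, and monotone slopes
  make it negative from \<open>\<delta>\<close> on. Hence its maximum over the compact interval
  \<open>{0..\<delta>}\<close> is positive, interior and global.\<close>

lemma (in prob_space) Legendre_sup_attained:
  fixes f :: "'a \<Rightarrow> real"
  defines "L \<equiv> \<lambda>\<theta>. ln (expectation (\<lambda>\<omega>. exp (\<theta> * f \<omega>)))"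
  assumes [measurable]: "f \<in> borel_measurable M"
    and int: "\<And>\<theta>. integrable M (\<lambda>\<omega>. exp (\<theta> * f \<omega>))"
    and mean: "expectation f = 0"
    and "0 < \<delta>" "0 < \<epsilon>" "\<epsilon> < L \<delta> / \<delta>"
  obtains \<theta>' where "0 < \<theta>'" "\<theta>' < \<delta>" "\<And>\<theta>. 0 \<le> \<theta> \<Longrightarrow> \<theta> * \<epsilon> - L \<theta> \<le> \<theta>' * \<epsilon> - L \<theta>'"
proof -
  let ?m = "\<lambda>\<theta>. expectation (\<lambda>\<omega>. exp (\<theta> * f \<omega>))"
  let ?\<phi> = "\<lambda>\<theta>. \<theta> * \<epsilon> - L \<theta>"
  have m_pos: "?m \<theta> > 0" for \<theta> by (rule expectation_exp_pos[OF int])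
  have der: "(?m has_real_derivative expectation (\<lambda>\<omega>. exp (\<theta> * f \<omega>) * f \<omega>)) (at \<theta>)" for \<theta>
  proof -
    have "integrable M (\<lambda>\<omega>. exp (2 * \<bar>f \<omega>\<bar>) * exp (\<theta> * f \<omega>))"
    proof (rule Bochner_Integration.integrable_bound)
      \<comment> \<open>The two-variable moment bound is used with \<open>f\<close> in both places
        and coefficient 0 on the second.\<close>
      show "integrable M (\<lambda>\<omega>. exp ((2 + \<bar>\<theta>\<bar>) * \<bar>f \<omega>\<bar> + 0 * \<bar>f \<omega>\<bar>))"
        by (rule integrable_exp_abs_add) (use int in auto)
      have "\<theta> * f \<omega> \<le> \<bar>\<theta>\<bar> * \<bar>f \<omega>\<bar>" for \<omega>
        by (metis abs_ge_self abs_mult)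
      thus "AE \<omega> in M. norm (exp (2 * \<bar>f \<omega>\<bar>) * exp (\<theta> * f \<omega>))
          \<le> norm (exp ((2 + \<bar>\<theta>\<bar>) * \<bar>f \<omega>\<bar> + 0 * \<bar>f \<omega>\<bar>))"
        by (auto simp flip: exp_add simp: algebra_simps)
    qed simp
    hence "((\<lambda>t. expectation (\<lambda>\<omega>. exp (\<theta> * f \<omega>) * exp (t * f \<omega>))) has_real_derivative
        expectation (\<lambda>\<omega>. exp (\<theta> * f \<omega>) * f \<omega>)) (at 0)"
      by (intro has_real_derivative_exp_tilted_integral) (simp_all add: mult.commute)
    \<comment> \<open>Taking the tilt \<open>exp (\<theta> * f)\<close> as weight turns the
      derivative at 0 into the derivative at \<open>\<theta>\<close> of the translated
      function.\<close>
    moreover have "(\<lambda>t. expectation (\<lambda>\<omega>. exp (\<theta> * f \<omega>) * exp (t * f \<omega>))) = (\<lambda>t. ?m (t + \<theta>))"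
      by (simp add: exp_add[symmetric] algebra_simps)
    ultimately show ?thesis
      using DERIV_shift[of ?m _ 0 \<theta>] by simp
  qed
  have "(L has_real_derivative inverse (?m 0) * expectation (\<lambda>\<omega>. exp (0 * f \<omega>) * f \<omega>)) (at 0)"
    unfolding L_def using m_pos[of 0] by (intro DERIV_chain2[OF DERIV_ln der])
  hence "(L has_real_derivative 0) (at 0)"
    using mean by simp
  hence "(?\<phi> has_real_derivative \<epsilon>) (at 0)"
    by (auto intro!: derivative_eq_intros)
  then obtain r where r: "r > 0" "\<And>h. 0 < h \<Longrightarrow> h < r \<Longrightarrow> ?\<phi> 0 < ?\<phi> h"
    using DERIV_pos_inc_right[of ?\<phi> \<epsilon> 0] \<open>\<epsilon> > 0\<close> by auto
  have L0: "L 0 = 0" by (simp add: L_def prob_space)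
  \<comment> \<open>Halving the minimum puts \<open>h\<close> strictly below both \<open>r\<close>
    and \<open>\<delta>\<close>, so it is a point of \<open>{0..\<delta>}\<close> where the
    objective is positive.\<close>
  define h where "h = min r \<delta> / 2"
  have h: "0 < h" "h < \<delta>" "?\<phi> h > 0"
    using r(1) r(2)[of h] \<open>\<delta> > 0\<close> L0 by (auto simp: h_def)
  have "continuous_on {0..\<delta>} ?m"
    using der DERIV_isCont continuous_at_imp_continuous_on by blast
  hence "continuous_on {0..\<delta>} ?\<phi>"
    unfolding L_def using m_pos by (intro continuous_intros) (auto simp: less_imp_neq[THEN not_sym])
  then obtain \<theta>' where \<theta>': "\<theta>' \<in> {0..\<delta>}" "\<And>\<theta>. \<theta> \<in> {0..\<delta>} \<Longrightarrow> ?\<phi> \<theta> \<le> ?\<phi> \<theta>'"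
    using continuous_attains_sup[of "{0..\<delta>}" ?\<phi>] \<open>\<delta> > 0\<close> by auto
  have pos: "?\<phi> \<theta>' > 0" using \<theta>'(2)[of h] h by auto
  have neg: "?\<phi> \<theta> < 0" if "\<delta> \<le> \<theta>" for \<theta>
  proof -
    have "\<theta> * L \<delta> \<le> \<delta> * L \<theta>"
      unfolding L_def by (rule ln_expectation_exp_scale_mono[OF int]) (use that \<open>\<delta> > 0\<close> in auto)
    moreover have "\<theta> * (\<epsilon> * \<delta>) < \<theta> * L \<delta>"
      using assms that by (intro mult_strict_left_mono) (auto simp: field_simps)
    ultimately have "\<delta> * (\<theta> * \<epsilon>) < \<delta> * L \<theta>" by (simp add: mult_ac)
    thus ?thesis using \<open>\<delta> > 0\<close> by simp
  qed
  show ?thesis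
  proof (rule that[of \<theta>'])
    show "0 < \<theta>'" using pos \<theta>'(1) L0 by (cases "\<theta>' = 0") auto
    show "\<theta>' < \<delta>" using neg[of \<theta>'] pos by force
    show "?\<phi> \<theta> \<le> ?\<phi> \<theta>'" if "0 \<le> \<theta>" for \<theta>
      using \<theta>'(2)[of \<theta>] neg[of \<theta>] pos that by (cases "\<theta> \<le> \<delta>") auto
  qed
qed

theorem theorem4p1:
  fixes M :: "'a measure"
    and X :: "'a \<Rightarrow> real"
    and F U :: "real \<Rightarrow> real"
  assumes "prob_space M"
    and "X \<in> borel_measurable M"
    and "F \<in> borel_measurable borel"
    and "U \<in> borel_measurable borel"
    and "\<And>\<theta>::real. integrable M (\<lambda>\<omega>. exp (\<theta> * F (X \<omega>)))"
    and "\<And>\<theta>::real. integrable M (\<lambda>\<omega>. exp (\<theta> * U (X \<omega>)))"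
    and "(\<integral>\<omega>. F (X \<omega>) \<partial>M) = 0"
    and "(\<integral>\<omega>. U (X \<omega>) \<partial>M) = 0"
    and "covariance M (\<lambda>\<omega>. F (X \<omega>)) (\<lambda>\<omega>. U (X \<omega>)) \<noteq> 0"
  shows "\<exists>\<epsilon>0>0. \<forall>\<epsilon>::real. 0 < \<epsilon> \<and> \<epsilon> < \<epsilon>0 \<longrightarrow>
           (\<exists>u0>0. \<forall>u\<in>{0<..<u0}. Delta M X F U \<epsilon> u > 0)"
proof -
  interpret prob_space M by fact

  \<comment> \<open>The centred variables and their integrability\<close>
  define f where "f = (\<lambda>\<omega>. F (X \<omega>))"
  define g where "g = (\<lambda>\<omega>. U (X \<omega>))"
  have f_meas [measurable]: "f \<in> borel_measurable M" and g_meas [measurable]: "g \<in> borel_measurable M"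
    unfolding f_def g_def using assms(2-4) by measurable
  have f_exp: "integrable M (\<lambda>\<omega>. exp (\<theta> * f \<omega>))" and g_exp: "integrable M (\<lambda>\<omega>. exp (\<theta> * g \<omega>))" for \<theta>
    using assms(5,6) by (simp_all add: f_def g_def)
  have f_mean: "expectation f = 0" and g_mean: "expectation g = 0"
    using assms(7,8) by (simp_all add: f_def g_def)
  have cov: "expectation (\<lambda>\<omega>. g \<omega> * f \<omega>) \<noteq> 0"
    using assms(7-9) by (simp add: covariance_def f_def g_def mult.commute)
  have exp_abs: "integrable M (\<lambda>\<omega>. exp (a * \<bar>f \<omega>\<bar> + b * \<bar>g \<omega>\<bar>))" for a b
    by (rule integrable_exp_abs_add) (use f_exp g_exp in auto)
  have f_int: "integrable M f"
  proof (rule Bochner_Integration.integrable_bound[OF exp_abs[of 1 0]])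
    have "\<bar>f \<omega>\<bar> \<le> exp \<bar>f \<omega>\<bar>" for \<omega>
      using exp_ge_add_one_self[of "\<bar>f \<omega>\<bar>"] by linarith
    thus "AE \<omega> in M. norm (f \<omega>) \<le> norm (exp (1 * \<bar>f \<omega>\<bar> + 0 * \<bar>g \<omega>\<bar>))" by simp
  qed simp
  \<comment> \<open>Nonzero covariance makes \<open>f\<close> nondegenerate; this is what will make
    \<open>L \<delta>\<close> strictly positive.\<close>
  have f_nonzero: "\<not> (AE \<omega> in M. f \<omega> = 0)"
  proof
    assume "AE \<omega> in M. f \<omega> = 0"
    hence "expectation (\<lambda>\<omega>. g \<omega> * f \<omega>) = expectation (\<lambda>\<omega>. 0)"
      by (intro integral_cong_AE) auto
    thus False using cov by simp
  qed

  \<comment> \<open>An interval to the right of 0 on which \<open>D\<close> does not vanish\<close>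
  define D where "D = (\<lambda>\<theta>. expectation (\<lambda>\<omega>. g \<omega> * exp (\<theta> * f \<omega>)))"
  have D_der: "(D has_real_derivative expectation (\<lambda>\<omega>. g \<omega> * f \<omega>)) (at 0)"
    unfolding D_def
  \<comment> \<open>Here the weight is \<open>g\<close> and the exponent is \<open>f\<close>; these
    roles are reversed for \<open>K\<close> below.\<close>
  proof (rule has_real_derivative_exp_tilted_integral)
    show "integrable M (\<lambda>\<omega>. \<bar>g \<omega>\<bar> * exp (2 * \<bar>f \<omega>\<bar>))"
    proof (rule Bochner_Integration.integrable_bound[OF exp_abs[of 2 1]])
      have "\<bar>g \<omega>\<bar> \<le> exp \<bar>g \<omega>\<bar>" for \<omega>
        using exp_ge_add_one_self[of "\<bar>g \<omega>\<bar>"] by linarith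
      thus "AE \<omega> in M. norm (\<bar>g \<omega>\<bar> * exp (2 * \<bar>f \<omega>\<bar>)) \<le> norm (exp (2 * \<bar>f \<omega>\<bar> + 1 * \<bar>g \<omega>\<bar>))"
        by (simp add: exp_add)
    qed simp
  qed simp_all
  have D0: "D 0 = 0" by (simp add: D_def g_mean)
  obtain \<delta> where \<delta>: "\<delta> > 0" "\<And>\<theta>. 0 < \<theta> \<Longrightarrow> \<theta> < \<delta> \<Longrightarrow> D \<theta> \<noteq> 0"
  proof (cases "expectation (\<lambda>\<omega>. g \<omega> * f \<omega>) > 0")
    case True
    then show ?thesis using DERIV_pos_inc_right[OF D_der] D0 that by fastforce
  next
    case False
    hence "expectation (\<lambda>\<omega>. g \<omega> * f \<omega>) < 0" using cov by simp
    then show ?thesis using DERIV_neg_dec_right[OF D_der] D0 that by fastforce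
  qed

  \<comment> \<open>The threshold \<open>L \<delta> / \<delta>\<close> and the attained value of
    \<open>Lambda_star\<close>\<close>
  define L where "L = (\<lambda>\<theta>. ln (expectation (\<lambda>\<omega>. exp (\<theta> * f \<omega>))))"
  have "expectation (\<lambda>\<omega>. exp (\<delta> * f \<omega>)) > 1"
    using f_int f_mean f_exp f_nonzero \<delta>(1) by (intro expectation_exp_gt_1) auto
  hence \<epsilon>0: "L \<delta> / \<delta> > 0" using \<delta>(1) by (simp add: L_def)

  show ?thesis
  proof (rule exI[of _ "L \<delta> / \<delta>"], rule conjI[OF \<epsilon>0], intro allI impI)
    fix \<epsilon> :: real assume \<epsilon>: "0 < \<epsilon> \<and> \<epsilon> < L \<delta> / \<delta>"
    obtain \<theta> where \<theta>: "0 < \<theta>" "\<theta> < \<delta>" "\<And>\<theta>'. 0 \<le> \<theta>' \<Longrightarrow> \<theta>' * \<epsilon> - L \<theta>' \<le> \<theta> * \<epsilon> - L \<theta>"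
      using Legendre_sup_attained[OF f_meas f_exp f_mean \<delta>(1), of \<epsilon>] \<epsilon> unfolding L_def by metis
    \<comment> \<open>Attainment makes the supremum finite, which rules out the default value 0 in
      \<open>Delta\<close> and makes its subtraction meaningful.\<close>
    have star: "Lambda_star M X F \<epsilon> = ereal (\<theta> * \<epsilon> - L \<theta>)"
      unfolding Lambda_star_def
    proof (rule SUP_eqI)
      show "ereal (\<theta>' * \<epsilon> - Lambda M X F \<theta>') \<le> ereal (\<theta> * \<epsilon> - L \<theta>)" if "\<theta>' \<in> {0..}" for \<theta>'
        using \<theta>(3)[of \<theta>'] that by (simp add: L_def Lambda_def f_def)
      show "ereal (\<theta> * \<epsilon> - L \<theta>) \<le> y"
        if "\<And>\<theta>'. \<theta>' \<in> {0..} \<Longrightarrow> ereal (\<theta>' * \<epsilon> - Lambda M X F \<theta>') \<le> y" for y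
        using that[of \<theta>] \<theta>(1) by (simp add: L_def Lambda_def f_def)
    qed

    \<comment> \<open>Perturbing the optimal tilt in the direction of \<open>g\<close>\<close>
    define K where "K = (\<lambda>t. expectation (\<lambda>\<omega>. exp (\<theta> * f \<omega>) * exp (t * g \<omega>)))"
    have le_abs: "\<theta> * f \<omega> \<le> \<theta> * \<bar>f \<omega>\<bar>" "t * g \<omega> \<le> \<bar>t\<bar> * \<bar>g \<omega>\<bar>" for t \<omega>
      using \<theta>(1) by (simp_all flip: abs_mult)
    have K_exp: "K t = expectation (\<lambda>\<omega>. exp (\<theta> * f \<omega> + t * g \<omega>))" for t
      by (simp add: K_def exp_add)
    have K_pos: "K t > 0" for t
      unfolding K_exp
    proof (rule expectation_exp_pos, rule Bochner_Integration.integrable_bound[OF exp_abs[of \<theta> "\<bar>t\<bar>"]])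
      show "AE \<omega> in M. norm (exp (\<theta> * f \<omega> + t * g \<omega>)) \<le> norm (exp (\<theta> * \<bar>f \<omega>\<bar> + \<bar>t\<bar> * \<bar>g \<omega>\<bar>))"
        using le_abs by (auto intro!: add_mono)
    qed simp
    have "(K has_real_derivative expectation (\<lambda>\<omega>. exp (\<theta> * f \<omega>) * g \<omega>)) (at 0)"
      unfolding K_def
    proof (rule has_real_derivative_exp_tilted_integral)
      show "integrable M (\<lambda>\<omega>. \<bar>exp (\<theta> * f \<omega>)\<bar> * exp (2 * \<bar>g \<omega>\<bar>))"
      proof (rule Bochner_Integration.integrable_bound[OF exp_abs[of \<theta> 2]])
        show "AE \<omega> in M. norm (\<bar>exp (\<theta> * f \<omega>)\<bar> * exp (2 * \<bar>g \<omega>\<bar>)) \<le> norm (exp (\<theta> * \<bar>f \<omega>\<bar> + 2 * \<bar>g \<omega>\<bar>))"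
          using le_abs(1) by (simp add: exp_add)
      qed simp
    qed simp_all
    hence K_der: "(K has_real_derivative D \<theta>) (at 0)"
      by (simp add: D_def mult.commute)
    have L_K: "L \<theta> = ln (K 0)" by (simp add: L_def K_def)
    \<comment> \<open>Here \<open>s\<close> is the perturbation, later \<open>- t\<close> or
      \<open>t\<close>, and \<open>t\<close> its size. The witness \<open>u0\<close> is the value of
      \<open>u\<close> at which the penalty \<open>t * u\<close> equals the logarithmic
      gain.\<close>
    have gain: "\<exists>u0>0. \<forall>u\<in>{0<..<u0}. \<theta> * \<epsilon> - L \<theta> < \<theta> * \<epsilon> - t * u - ln (K s)"
      if "t > 0" "K s < K 0" for t s
    proof (rule exI[of _ "(ln (K 0) - ln (K s)) / t"], intro conjI ballI)
      show "0 < (ln (K 0) - ln (K s)) / t" using that K_pos by simp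
      show "\<theta> * \<epsilon> - L \<theta> < \<theta> * \<epsilon> - t * u - ln (K s)" if "u \<in> {0<..<(ln (K 0) - ln (K s)) / t}" for u
        using that \<open>t > 0\<close> by (simp add: L_K field_simps)
    qed
    have Delta_pos: "Delta M X F U \<epsilon> u > 0"
      if "ereal c \<le> max (Lambda_plus_star M X F U \<epsilon> u) (Gamma_plus_star M X F U \<epsilon> u)"
        "\<theta> * \<epsilon> - L \<theta> < c" for c u
    proof -
      have "ereal (\<theta> * \<epsilon> - L \<theta>) < max (Lambda_plus_star M X F U \<epsilon> u) (Gamma_plus_star M X F U \<epsilon> u)"
        using that by (meson less_ereal.simps(1) less_le_trans)
      thus ?thesis unfolding Delta_def star
        by (simp add: ereal_less_minus_iff)
    qed
    show "\<exists>u0>0. \<forall>u\<in>{0<..<u0}. Delta M X F U \<epsilon> u > 0"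
    \<comment> \<open>\<open>Lambda_plus_star\<close> perturbs by \<open>- t\<close> and
      \<open>Gamma_plus_star\<close> by \<open>t\<close>, so the sign of the slope
      \<open>D \<theta>\<close> of \<open>K\<close> at 0 selects the exponent that exceeds
      \<open>Lambda_star\<close>.\<close>
    proof (cases "D \<theta> > 0")
      case True
      then obtain r where "r > 0" "\<And>t. 0 < t \<Longrightarrow> t < r \<Longrightarrow> K (0 - t) < K 0"
        using DERIV_pos_inc_left[OF K_der] by blast
      then obtain t where t: "t > 0" "K (- t) < K 0"
        by (metis diff_0 field_lbound_gt_zero)
      have "ereal (\<theta> * \<epsilon> - t * u - ln (K (- t))) \<le> Lambda_plus_star M X F U \<epsilon> u" for u
        unfolding Lambda_plus_star_def
        by (rule SUP_upper2[of "(\<theta>, t)"]) (use t(1) \<theta>(1) in \<open>auto simp: K_exp f_def g_def\<close>)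
      thus ?thesis using gain[OF t] Delta_pos by (meson max.coboundedI1)
    next
      case False
      \<comment> \<open>Since \<open>0 < \<theta> < \<delta>\<close>, the value
        \<open>D \<theta>\<close> is nonzero, which leaves only the negative sign.\<close>
      hence "D \<theta> < 0" using \<delta>(2)[OF \<theta>(1,2)] by simp
      then obtain r where "r > 0" "\<And>t. 0 < t \<Longrightarrow> t < r \<Longrightarrow> K (0 + t) < K 0"
        using DERIV_neg_dec_right[OF K_der] by blast
      then obtain t where t: "t > 0" "K t < K 0"
        by (metis add_0 field_lbound_gt_zero)
      have "ereal (\<theta> * \<epsilon> - t * u - ln (K t)) \<le> Gamma_plus_star M X F U \<epsilon> u" for u
        unfolding Gamma_plus_star_def
        by (rule SUP_upper2[of "(\<theta>, t)"]) (use t(1) \<theta>(1) in \<open>auto simp: K_exp f_def g_def\<close>)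
      thus ?thesis using gain[OF t] Delta_pos by (meson max.coboundedI2)
    qed
  qed
qed

end
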